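(* If $x(t)$ is a solution to the reduced Chazy V equation $$x'''=2xx''+4(x')^2-2x^2x',$$ then so is $$\frac{x^3-3xx'+x''}{x^2-x'}$$ (whenever the denominator does not vanish identically). This transformation is involutive.
   Context: Solutions are (local) holomorphic or meromorphic functions of one complex variable $t$. A substitution $x\mapsto R(x,x',x'')$, with $R$ a rational function of three variables, is regarded as a transformation as follows: let $W=y\,\partial/\partial x+z\,\partial/\partial y+(2xz+4y^2-2x^2y)\,\partial/\partial z$ be the vector field on $\mathbb{C}^3$ equivalent to the equation (with $y=x'$, $z=x''$); the substitution is extended to $x'$ and $x''$ using the equation, giving the rational self-map $(x,y,z)\mapsto(R,\,W R,\,W(W R))$ of $\mathbb{C}^3$. Involutive means that the composition of this rational map with itself is the identity. *)

theory Defs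
  imports
    "HOL-Complex_Analysis.Complex_Analysis"
    "HOL-Computational_Algebra.Computational_Algebra"
    "HOL-Computational_Algebra.Field_as_Ring"
begin

text \<open>
  Both formulas below are polymorphic, so that they can be applied to the values
  \<open>x(t), x'(t), x''(t)\<close> of a function and to the coordinate functions in \<open>\<complex>(x,y,z)\<close>.
\<close>

definition chazyV_rhs :: "'a::comm_ring_1 \<Rightarrow> 'a \<Rightarrow> 'a \<Rightarrow> 'a" where
  "chazyV_rhs x y z = 2 * x * z + 4 * y ^ 2 - 2 * x ^ 2 * y"

definition chazyV_sub :: "'a::field \<Rightarrow> 'a \<Rightarrow> 'a \<Rightarrow> 'a" where
  "chazyV_sub x y z = (x ^ 3 - 3 * x * y + z) / (x ^ 2 - y)"

text \<open>
  A function that is \<open>meromorphic_on\<close> a set may take arbitrary values at its poles and at other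
  isolated points, so the equation is only demanded where the function is analytic.
  For a function holomorphic on \<open>U\<close> this is the equation at every point of \<open>U\<close>.
\<close>

definition chazyV_solution_on :: "(complex \<Rightarrow> complex) \<Rightarrow> complex set \<Rightarrow> bool" where
  "chazyV_solution_on x U \<longleftrightarrow>
     x meromorphic_on U \<and>
     (\<forall>t\<in>U. x analytic_on {t} \<longrightarrow>
        (deriv ^^ 3) x t = chazyV_rhs (x t) (deriv x t) ((deriv ^^ 2) x t))"

text \<open>
  The polynomial ring \<open>\<complex>[x,y,z]\<close> is represented as \<open>\<complex>[x][y][z]\<close>: the variable \<open>z\<close> belongs to the
  outermost \<open>poly\<close> constructor and \<open>x\<close> to the innermost one.
\<close>

type_synonym poly3 = "complex poly poly poly"
type_synonym ratfun3 = "poly3 fract"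

definition RX :: ratfun3 where "RX = to_fract [:[:[:0, 1:]:]:]"
definition RY :: ratfun3 where "RY = to_fract [:[:0, 1:]:]"
definition RZ :: ratfun3 where "RZ = to_fract [:0, 1:]"

definition ratfun3_const :: "complex \<Rightarrow> ratfun3" where
  "ratfun3_const c = to_fract [:[:[:c:]:]:]"

text \<open>
  Extension of a derivation from polynomials to rational functions by the quotient rule,
  evaluated on the representation in lowest terms.
\<close>

definition fract_deriv :: "(poly3 \<Rightarrow> poly3) \<Rightarrow> ratfun3 \<Rightarrow> ratfun3" where
  "fract_deriv D f =
     (case quot_of_fract f of (p, q) \<Rightarrow> to_fract (D p * q - p * D q) / to_fract (q ^ 2))"

definition partial_x :: "ratfun3 \<Rightarrow> ratfun3" where
  "partial_x = fract_deriv (map_poly (map_poly pderiv))"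
definition partial_y :: "ratfun3 \<Rightarrow> ratfun3" where
  "partial_y = fract_deriv (map_poly pderiv)"
definition partial_z :: "ratfun3 \<Rightarrow> ratfun3" where
  "partial_z = fract_deriv pderiv"

definition chazyV_field :: "ratfun3 \<Rightarrow> ratfun3" where
  "chazyV_field f = RY * partial_x f + RZ * partial_y f + chazyV_rhs RX RY RZ * partial_z f"

type_synonym ratmap3 = "ratfun3 \<times> ratfun3 \<times> ratfun3"

definition poly3_subst :: "poly3 \<Rightarrow> ratmap3 \<Rightarrow> ratfun3" where
  "poly3_subst p G = (case G of (u, v, w) \<Rightarrow>
     poly (map_poly (\<lambda>q. poly (map_poly (\<lambda>r. poly (map_poly ratfun3_const r) u) q) v) p) w)"

text \<open>
  \<open>ratfun3_subst f G\<close> is the composition \<open>f \<circ> G\<close>. It makes sense iff the denominator of \<open>f\<close> in lowest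
  terms does not vanish identically along \<open>G\<close>.
\<close>

definition ratfun3_substitutable :: "ratfun3 \<Rightarrow> ratmap3 \<Rightarrow> bool" where
  "ratfun3_substitutable f G \<longleftrightarrow> poly3_subst (snd (quot_of_fract f)) G \<noteq> 0"

definition ratfun3_subst :: "ratfun3 \<Rightarrow> ratmap3 \<Rightarrow> ratfun3" where
  "ratfun3_subst f G =
     poly3_subst (fst (quot_of_fract f)) G / poly3_subst (snd (quot_of_fract f)) G"

definition ratmap3_composable :: "ratmap3 \<Rightarrow> ratmap3 \<Rightarrow> bool" where
  "ratmap3_composable F G \<longleftrightarrow> (case F of (f, g, h) \<Rightarrow>
     ratfun3_substitutable f G \<and> ratfun3_substitutable g G \<and> ratfun3_substitutable h G)"

definition ratmap3_comp :: "ratmap3 \<Rightarrow> ratmap3 \<Rightarrow> ratmap3" where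
  "ratmap3_comp F G = (case F of (f, g, h) \<Rightarrow>
     (ratfun3_subst f G, ratfun3_subst g G, ratfun3_subst h G))"

definition ratmap3_id :: ratmap3 where
  "ratmap3_id = (RX, RY, RZ)"

definition ratmap3_involutive :: "ratmap3 \<Rightarrow> bool" where
  "ratmap3_involutive F \<longleftrightarrow> ratmap3_composable F F \<and> ratmap3_comp F F = ratmap3_id"

definition chazyV_ratmap :: "ratfun3 \<Rightarrow> ratmap3" where
  "chazyV_ratmap R = (R, chazyV_field R, chazyV_field (chazyV_field R))"

end

theory Submission
  imports Defs
begin

text \<open>
  Put \<open>D = x\<^sup>2 - y\<close> and \<open>q = (2xy - z) / D\<close>, the logarithmic derivative of \<open>D\<close> along the flow.
  In the coordinates \<open>(x, y, q)\<close> the vector field is polynomial,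
  \<open>x' = y\<close>, \<open>y' = 2xy - qD\<close>, \<open>q' = 2y - q\<^sup>2\<close>, because Chazy V is equivalent to \<open>D'' = 2yD\<close>.
  The substitution is \<open>x \<mapsto> x - q\<close>, and its extension to the derivatives becomes
  \<open>(x, y, q) \<mapsto> (x - q, q\<^sup>2 - y, -q)\<close>, which is visibly an involution and preserves the vector field.
  The denominator after substitution is \<open>P / D\<close>, where \<open>P = x\<^sup>4 - 4x\<^sup>2y - y\<^sup>2 + 2xz\<close> is a first integral.
\<close>

section \<open>The equation in the coordinates x, y, q\<close>

text \<open>The quotient is the logarithmic derivative of \<open>x ^ 2 - y\<close> along the flow.
  Doublings are written as sums so that later terms are built from the coordinates only by
  operations for which derivation and composition rules are proved.\<close>

lemma chazyV_sub_eq: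
  fixes x y z :: "'a::field"
  assumes "x ^ 2 - y \<noteq> 0"
  shows "chazyV_sub x y z = x - (x * y + x * y - z) / (x ^ 2 - y)"
proof -
  have "x * (x ^ 2 - y) - (x * y + x * y - z) = x ^ 3 - 3 * x * y + z" by algebra
  then show ?thesis
    using assms by (simp add: chazyV_sub_def diff_divide_distrib[symmetric] eq_divide_eq field_simps)
qed

text \<open>The left side is the quotient rule for N/D with D = x^2 - y and N = D' = 2xy - z. The
  equation gives N' = 2yD, so q' = N'/D - (N/D)^2 = 2y - q^2.\<close>

lemma log_deriv_flow_eq:
  fixes x y z q :: "'a::field"
  assumes D: "x ^ 2 - y \<noteq> 0" and q: "q = (x * y + x * y - z) / (x ^ 2 - y)"
  shows "((y * y + x * z + (y * y + x * z) - chazyV_rhs x y z) * (x ^ 2 - y)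
            - (x * y + x * y - z) * (x * y + x * y - z)) / (x ^ 2 - y) ^ 2 = y + y - q ^ 2"
proof -
  have n: "x * y + x * y - z = q * (x ^ 2 - y)"
    using D q by simp
  have "(y * y + x * z + (y * y + x * z) - chazyV_rhs x y z) * (x ^ 2 - y)
            - (x * y + x * y - z) * (x * y + x * y - z)
        = (y + y) * (x ^ 2 - y) ^ 2 - (x * y + x * y - z) ^ 2"
    unfolding chazyV_rhs_def by algebra
  also have "\<dots> = (y + y - q ^ 2) * (x ^ 2 - y) ^ 2"
    unfolding n by algebra
  finally show ?thesis
    using D by simp
qed

text \<open>With p = q' and p' = 2z - 2qp, the left side is the flow derivative of 2qp - z, hence
  the third derivative of x - q. The hypothesis is linear in z; eliminating z leaves a polynomial
  identity in x, y, q.\<close>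

lemma chazyV_rhs_transformed:
  fixes x y z q :: "'a::comm_ring_1"
  assumes "q * (x ^ 2 - y) = x * y + x * y - z"
  defines "p \<equiv> y + y - q ^ 2"
  shows "2 * (p * p + q * (2 * z - 2 * (q * p))) - chazyV_rhs x y z =
         chazyV_rhs (x - q) (q ^ 2 - y) (2 * (q * p) - z)"
proof -
  have z: "z = x * y + x * y - q * (x ^ 2 - y)"
    using assms(1) by simp
  show ?thesis
    unfolding chazyV_rhs_def p_def z by (simp add: algebra_simps power2_eq_square)
qed

text \<open>Expanding gives x^2 + y - 2xq on the left; multiplying by D = x^2 - y and using qD = 2xy
  - z yields the numerator, which is the first integral P.\<close>

lemma chazyV_transformed_denominator:
  fixes x y z q :: "'a::field"
  assumes "x ^ 2 - y \<noteq> 0" and "q = (x * y + x * y - z) / (x ^ 2 - y)"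
  shows "(x - q) ^ 2 - (q ^ 2 - y) =
    ((x ^ 2 + y) * (x ^ 2 - y) - (x + x) * (x * y + x * y - z)) / (x ^ 2 - y)"
proof -
  have n: "x * y + x * y - z = q * (x ^ 2 - y)"
    using assms by simp
  have "((x - q) ^ 2 - (q ^ 2 - y)) * (x ^ 2 - y) =
    (x ^ 2 + y) * (x ^ 2 - y) - (x + x) * (x * y + x * y - z)"
    unfolding n by algebra
  then show ?thesis
    using assms(1) by (simp add: eq_divide_eq)
qed

text \<open>The sign change of q is what makes the map an involution. Once z is expressed through q,
  it reduces to the polynomial identity 2XY - Z = -q(X^2 - Y).\<close>

lemma chazyV_transformed_log_deriv:
  fixes x y z q :: "'a::field"
  assumes D: "x ^ 2 - y \<noteq> 0" and q: "q = (x * y + x * y - z) / (x ^ 2 - y)"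
    and E: "(x - q) ^ 2 - (q ^ 2 - y) \<noteq> 0"
  defines "X \<equiv> x - q" and "Y \<equiv> q ^ 2 - y" and "Z \<equiv> 2 * (q * (y + y - q ^ 2)) - z"
  shows "(X * Y + X * Y - Z) / (X ^ 2 - Y) = - q"
proof -
  have z: "z = x * y + x * y - q * (x ^ 2 - y)"
    using D q by simp
  have "X * Y + X * Y - Z = - q * (X ^ 2 - Y)"
    unfolding X_def Y_def Z_def z by algebra
  then show ?thesis
    using E by (simp add: X_def Y_def)
qed

section \<open>Solutions\<close>

lemma chazyV_sub_solution_open:
  fixes x :: "complex \<Rightarrow> complex"
  assumes V: "open V" and holo: "x holomorphic_on V"
    and nz: "\<And>t. t \<in> V \<Longrightarrow> x t ^ 2 - deriv x t \<noteq> 0"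
    and eqn: "\<And>t. t \<in> V \<Longrightarrow>
      (deriv ^^ 3) x t = chazyV_rhs (x t) (deriv x t) ((deriv ^^ 2) x t)"
    and t: "t \<in> V"
  defines "f \<equiv> (\<lambda>t. chazyV_sub (x t) (deriv x t) ((deriv ^^ 2) x t))"
  shows "(deriv ^^ 3) f t = chazyV_rhs (f t) (deriv f t) ((deriv ^^ 2) f t)"
proof -
  define y z where "y = deriv x" and "z = (deriv ^^ 2) x"
  define q where "q t = (x t * y t + x t * y t - z t) / (x t ^ 2 - y t)" for t
  have dx: "(x has_field_derivative y t) (at t)" if "t \<in> V" for t
    using holomorphic_derivI[OF holo V that] by (simp add: y_def)
  have dy: "(y has_field_derivative z t) (at t)" if "t \<in> V" for t
    using has_field_derivative_higher_deriv[OF holo V that, of 1]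
    by (simp add: y_def z_def numeral_2_eq_2)
  have dz: "(z has_field_derivative chazyV_rhs (x t) (y t) (z t)) (at t)" if "t \<in> V" for t
    using has_field_derivative_higher_deriv[OF holo V that, of 2] eqn[OF that]
    by (simp add: y_def z_def numeral_3_eq_3 numeral_2_eq_2)
  have nz': "x t ^ 2 - y t \<noteq> 0" if "t \<in> V" for t
    using nz[OF that] by (simp add: y_def)
  have dq: "(q has_field_derivative y t + y t - q t ^ 2) (at t)" if "t \<in> V" for t
  proof -
    have "(q has_field_derivative
      ((y t * y t + x t * z t + (y t * y t + x t * z t) - chazyV_rhs (x t) (y t) (z t))
          * (x t ^ 2 - y t)
        - (x t * y t + x t * y t - z t) * (x t * y t + x t * y t - z t)) / (x t ^ 2 - y t) ^ 2) (at t)"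
      unfolding q_def
      by (rule derivative_eq_intros dx[OF that] dy[OF that] dz[OF that] refl nz'[OF that])+
        (simp add: power2_eq_square algebra_simps)
    then show ?thesis
      by (subst (asm) log_deriv_flow_eq[OF nz'[OF that] q_def])
  qed
  \<comment> \<open>Each closed form is known only on \<open>V\<close>. Openness of \<open>V\<close>
    makes it valid near \<open>t\<close>, so it may be differentiated in place of the iterated
    derivative of \<open>f\<close>.\<close>
  have deriv_eq: "deriv g t = h t"
    if "t \<in> V" and "\<And>s. s \<in> V \<Longrightarrow> g s = k s" and "(k has_field_derivative h t) (at t)"
    for g k h :: "complex \<Rightarrow> complex" and t
    by (intro DERIV_imp_deriv has_field_derivative_transform_within_open[OF that(3) V that(1)])
      (simp add: that(2))
  have f: "f t = x t - q t" if "t \<in> V" for t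
    using chazyV_sub_eq[OF nz'[OF that]] by (simp add: f_def q_def y_def z_def)
  have f1: "deriv f t = q t ^ 2 - y t" if "t \<in> V" for t
    by (rule deriv_eq[OF that f], assumption,
        (rule derivative_eq_intros dx[OF that] dq[OF that] refl)+, simp)
  define p where "p = (\<lambda>t. y t + y t - q t ^ 2)"
  have dq': "(q has_field_derivative p t) (at t)" if "t \<in> V" for t
    using dq[OF that] by (simp add: p_def)
  have dp: "(p has_field_derivative 2 * z t - 2 * (q t * p t)) (at t)" if "t \<in> V" for t
    unfolding p_def
    by ((rule derivative_eq_intros dy[OF that] dq[OF that] refl)+, simp)
  have f2: "(deriv ^^ 2) f t = 2 * (q t * p t) - z t" if "t \<in> V" for t
    unfolding numeral_2_eq_2 funpow.simps o_def id_def
    by (rule deriv_eq[OF that f1], assumption,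
        (rule derivative_eq_intros dy[OF that] dq'[OF that] refl)+, simp)
  have "(deriv ^^ 3) f t = deriv ((deriv ^^ 2) f) t"
    by (simp add: numeral_3_eq_3 numeral_2_eq_2)
  also have "\<dots> = 2 * (p t * p t + q t * (2 * z t - 2 * (q t * p t))) - chazyV_rhs (x t) (y t) (z t)"
    by (rule deriv_eq[OF t f2], assumption,
        (rule derivative_eq_intros dz[OF t] dq'[OF t] dp[OF t] refl)+, simp add: algebra_simps)
  also have "\<dots> = chazyV_rhs (x t - q t) (q t ^ 2 - y t) (2 * (q t * p t) - z t)"
    unfolding p_def
    by (rule chazyV_rhs_transformed) (use nz'[OF t] in \<open>simp add: q_def\<close>)
  finally show ?thesis
    using f[OF t] f1[OF t] f2[OF t] by simp
qed

section \<open>Passage from holomorphic to meromorphic solutions\<close>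

lemma analytic_at_eq_of_eventually_eq:
  fixes f g :: "complex \<Rightarrow> complex"
  assumes "f analytic_on {t}" "g analytic_on {t}" and ev: "\<forall>\<^sub>F s in at t. f s = g s"
  shows "f t = g t"
proof -
  have f: "(f \<longlongrightarrow> f t) (at t)"
    using assms(1) analytic_at_imp_isCont isContD by blast
  have "(g \<longlongrightarrow> g t) (at t)"
    using assms(2) analytic_at_imp_isCont isContD by blast
  then have "(f \<longlongrightarrow> g t) (at t)"
    using tendsto_cong[OF ev] by blast
  with f show ?thesis
    by (intro tendsto_unique[of "at t" f]) simp_all
qed

text \<open>By connectedness, one nonzero value of the denominator at a point of analyticity forces
  it to be nonzero off a sparse set. There the holomorphic case applies; at the remaining points
  where the new function is analytic, the equation follows by continuity.\<close>

lemma chazyV_sub_solution_on: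
  fixes x :: "complex \<Rightarrow> complex"
  assumes U: "open U" "connected U" and sol: "chazyV_solution_on x U"
    and nz: "\<not> (\<forall>t\<in>U. x analytic_on {t} \<longrightarrow> x t ^ 2 - deriv x t = 0)"
  shows "chazyV_solution_on (\<lambda>t. chazyV_sub (x t) (deriv x t) ((deriv ^^ 2) x t)) U"
proof -
  define f where "f = (\<lambda>t. chazyV_sub (x t) (deriv x t) ((deriv ^^ 2) x t))"
  define D where "D = (\<lambda>t. x t ^ 2 - deriv x t)"
  have mero: "x meromorphic_on U"
    and eqn: "\<And>t. t \<in> U \<Longrightarrow> x analytic_on {t} \<Longrightarrow>
      (deriv ^^ 3) x t = chazyV_rhs (x t) (deriv x t) ((deriv ^^ 2) x t)"
    using sol by (auto simp: chazyV_solution_on_def)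
  have mero_f: "f meromorphic_on U"
    unfolding f_def chazyV_sub_def by (intro meromorphic_intros mero)
  have mero_D: "D meromorphic_on U"
    unfolding D_def by (intro meromorphic_intros mero)
  obtain t0 where t0: "t0 \<in> U" "x analytic_on {t0}" "D t0 \<noteq> 0"
    using nz by (auto simp: D_def)
  have "D analytic_on {t0}"
    unfolding D_def by (intro analytic_intros t0)
  \<comment> \<open>Vanishing on a punctured neighbourhood would give \<open>D t0 = 0\<close> by
    continuity.\<close>
  have "\<not> (\<forall>\<^sub>F t in at t0. D t = 0)"
    using analytic_at_eq_of_eventually_eq[OF \<open>D analytic_on {t0}\<close> analytic_on_const, of 0] t0(3)
    by auto
  then have "\<not> (\<forall>\<^sub>\<approx>t\<in>U. D t = 0)"
    using t0(1) U(1) by (auto simp: eventually_cosparse_open_eq)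
  then have nz_D: "\<forall>\<^sub>\<approx>t\<in>U. D t \<noteq> 0"
    using meromorphic_imp_constant_or_avoid[OF mero_D U] by blast
  have good: "\<forall>\<^sub>\<approx>t\<in>U. t \<in> U \<and> x analytic_on {t} \<and> D t \<noteq> 0"
    using eventually_in_cosparse[OF order_refl U(1)] meromorphic_on_imp_analytic_cosparse[OF mero] nz_D
    by eventually_elim auto
  have "(deriv ^^ 3) f t = chazyV_rhs (f t) (deriv f t) ((deriv ^^ 2) f t)"
    if t: "t \<in> U" and an: "f analytic_on {t}" for t
  proof (rule analytic_at_eq_of_eventually_eq[of "(deriv ^^ 3) f" t
      "\<lambda>t. chazyV_rhs (f t) (deriv f t) ((deriv ^^ 2) f t)"])
    show "(deriv ^^ 3) f analytic_on {t}"
      by (intro analytic_intros an)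
    show "(\<lambda>t. chazyV_rhs (f t) (deriv f t) ((deriv ^^ 2) f t)) analytic_on {t}"
      unfolding chazyV_rhs_def by (intro analytic_intros an)
    \<comment> \<open>The point \<open>t\<close> itself may be a pole of \<open>x\<close> or a zero
      of \<open>D\<close>, so the holomorphic case is applied on a punctured neighbourhood
      only.\<close>
    have "\<forall>\<^sub>F s in at t. s \<in> U \<and> x analytic_on {s} \<and> D s \<noteq> 0"
      using good t U(1) by (simp add: eventually_cosparse_open_eq)
    then obtain S where S: "open S" "t \<in> S"
      "\<And>s. s \<in> S - {t} \<Longrightarrow> s \<in> U \<and> x analytic_on {s} \<and> D s \<noteq> 0"
      unfolding eventually_at_topological by blast
    have "open (S - {t})"
      using S(1) by blast
    have "x analytic_on (S - {t})"
      using S(3) analytic_on_analytic_at by blast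
    then have holo: "x holomorphic_on (S - {t})"
      by (rule analytic_imp_holomorphic)
    have "(deriv ^^ 3) f s = chazyV_rhs (f s) (deriv f s) ((deriv ^^ 2) f s)" if "s \<in> S - {t}" for s
      unfolding f_def
      by (rule chazyV_sub_solution_open[OF \<open>open (S - {t})\<close> holo _ eqn that])
        (use S(3) in \<open>auto simp: D_def\<close>)
    then show "\<forall>\<^sub>F s in at t. (deriv ^^ 3) f s = chazyV_rhs (f s) (deriv f s) ((deriv ^^ 2) f s)"
      unfolding eventually_at_topological using S(1,2) by blast
  qed
  then show ?thesis
    using mero_f by (simp add: chazyV_solution_on_def f_def)
qed

section \<open>Derivations of the rational function field\<close>

definition is_derivation :: "('a::comm_ring_1 \<Rightarrow> 'a) \<Rightarrow> bool" where
  "is_derivation D \<longleftrightarrow>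
     (\<forall>p q. D (p + q) = D p + D q) \<and> (\<forall>p q. D (p * q) = D p * q + p * D q)"

lemma is_derivation_add: "is_derivation D \<Longrightarrow> D (p + q) = D p + D q"
  and is_derivation_mult: "is_derivation D \<Longrightarrow> D (p * q) = D p * q + p * D q"
  by (simp_all add: is_derivation_def)

lemma is_derivation_0: "is_derivation D \<Longrightarrow> D 0 = 0"
  using is_derivation_add[of D 0 0] by simp

lemma is_derivation_1: "is_derivation D \<Longrightarrow> D 1 = 0"
  using is_derivation_mult[of D 1 1] by simp

lemma is_derivation_diff: "is_derivation D \<Longrightarrow> D (p - q) = D p - D q"
  using is_derivation_add[of D "p - q" q] by (simp add: algebra_simps)

lemma is_derivation_power2: "is_derivation D \<Longrightarrow> D (p ^ 2) = 2 * (p * D p)"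
  by (simp add: power2_eq_square is_derivation_mult algebra_simps)

lemma is_derivation_divide:
  fixes D :: "'a::field \<Rightarrow> 'a"
  assumes "is_derivation D" "g \<noteq> 0"
  shows "D (f / g) = (D f * g - f * D g) / g ^ 2"
proof -
  have "D f = D (f / g) * g + f / g * D g"
    using is_derivation_mult[OF assms(1), of "f / g" g] assms(2) by simp
  then show ?thesis
    using assms(2) by (simp add: field_simps power2_eq_square)
qed

lemma is_derivation_pderiv: "is_derivation (pderiv :: 'a::idom poly \<Rightarrow> 'a poly)"
  by (simp add: is_derivation_def pderiv_add pderiv_mult algebra_simps)

text \<open>Coefficients of a product are finite convolution sums, through which \<open>D\<close>
  passes by additivity and the Leibniz rule. Applied to \<open>pderiv\<close>, this yields the
  partial derivatives in the inner variables.\<close>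

lemma is_derivation_map_poly:
  assumes D: "is_derivation D"
  shows "is_derivation (map_poly D)"
  unfolding is_derivation_def
proof (intro conjI allI)
  note c = coeff_map_poly[of D, OF is_derivation_0[OF D]]
  fix p q
  show "map_poly D (p + q) = map_poly D p + map_poly D q"
    by (rule poly_eqI) (simp add: c is_derivation_add[OF D])
  have "D (sum f A) = (\<Sum>i\<in>A. D (f i))" if "finite A" for f and A :: "nat set"
    using that by induction (simp_all add: is_derivation_0[OF D] is_derivation_add[OF D])
  then show "map_poly D (p * q) = map_poly D p * q + p * map_poly D q"
    by (intro poly_eqI) (simp add: c coeff_mult is_derivation_mult[OF D] sum.distrib)
qed

section \<open>Extension of derivations from polynomials to fractions\<close>

lemma fract_rep:
  fixes f :: ratfun3
  obtains a b where "b \<noteq> 0" "f = to_fract a / to_fract b"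
  using Fract_quot_of_fract[of f] snd_quot_of_fract_nonzero[of f] by (metis Fract_conv_to_fract)

lemma fract_rep_cross_mult:
  fixes f :: ratfun3
  assumes "b \<noteq> 0" "f = to_fract a / to_fract b"
  shows "fst (quot_of_fract f) * b = a * snd (quot_of_fract f)"
proof -
  have "to_fract (fst (quot_of_fract f)) / to_fract (snd (quot_of_fract f)) = to_fract a / to_fract b"
    using assms(2) by (metis Fract_conv_to_fract Fract_quot_of_fract)
  then have "to_fract (fst (quot_of_fract f) * b) = to_fract (a * snd (quot_of_fract f))"
    using assms(1) by (simp add: frac_eq_eq)
  then show ?thesis
    by (simp only: to_fract_eq_iff)
qed

text \<open>The definition uses lowest terms p/q, but any representation a/b gives the same value:
  the Leibniz rule applied to pb = aq turns one quotient rule into the other. Sums and products can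
  then be differentiated over a common denominator without reducing them.\<close>

lemma fract_deriv_divide:
  assumes D: "is_derivation D" and b: "b \<noteq> 0"
  shows "fract_deriv D (to_fract a / to_fract b) =
    (to_fract (D a) * to_fract b - to_fract a * to_fract (D b)) / to_fract b ^ 2"
proof -
  define f where "f = to_fract a / to_fract b"
  obtain p q where pq: "quot_of_fract f = (p, q)"
    by (cases "quot_of_fract f")
  have q: "q \<noteq> 0"
    using snd_quot_of_fract_nonzero[of f] pq by simp
  have e: "p * b = a * q"
    using fract_rep_cross_mult[OF b f_def] pq by simp
  have d: "D p * b + p * D b = D a * q + a * D q"
    using arg_cong[OF e, of D] by (simp add: is_derivation_mult[OF D])
  have "(D p * q - p * D q) * b ^ 2 = (D p * b) * q * b - (p * b) * D q * b"
    by algebra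
  also have "\<dots> = (D a * b - a * D b) * q ^ 2"
    using e d by algebra
  finally have "to_fract ((D p * q - p * D q) * b ^ 2) = to_fract ((D a * b - a * D b) * q ^ 2)"
    by simp
  then have "to_fract (D p * q - p * D q) / to_fract (q ^ 2) =
      to_fract (D a * b - a * D b) / to_fract (b ^ 2)"
    using q b by (simp only: to_fract_mult) (simp add: frac_eq_eq)
  then show ?thesis
    unfolding fract_deriv_def f_def[symmetric] pq by (simp add: power2_eq_square)
qed

lemma is_derivation_fract_deriv:
  assumes D: "is_derivation D"
  shows "is_derivation (fract_deriv D)"
  unfolding is_derivation_def
proof (intro conjI allI)
  fix f g :: ratfun3
  obtain a b c d where f: "b \<noteq> 0" "f = to_fract a / to_fract b"
    and g: "d \<noteq> 0" "g = to_fract c / to_fract d"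
    by (metis fract_rep)
  have bd: "b * d \<noteq> 0"
    using f g by simp
  have nz: "to_fract b \<noteq> 0" "to_fract d \<noteq> 0"
    using f g by simp_all
  note df = fract_deriv_divide[OF D f(1), of a, folded f(2)]
  note dg = fract_deriv_divide[OF D g(1), of c, folded g(2)]
  have sum: "f + g = to_fract (a * d + c * b) / to_fract (b * d)"
    using nz unfolding f(2) g(2) by (simp add: add_frac_eq)
  have prod: "f * g = to_fract (a * c) / to_fract (b * d)"
    unfolding f(2) g(2) by simp
  show "fract_deriv D (f + g) = fract_deriv D f + fract_deriv D g"
    unfolding sum fract_deriv_divide[OF D bd] df dg using nz
    by (simp add: is_derivation_add[OF D] is_derivation_mult[OF D] field_simps power2_eq_square)
  show "fract_deriv D (f * g) = fract_deriv D f * g + f * fract_deriv D g"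
    unfolding prod fract_deriv_divide[OF D bd] df dg unfolding f(2) g(2) using nz
    by (simp add: is_derivation_mult[OF D] field_simps power2_eq_square)
qed

lemma fract_deriv_to_fract:
  assumes "is_derivation D"
  shows "fract_deriv D (to_fract a) = to_fract (D a)"
  using fract_deriv_divide[OF assms, of 1 a] by (simp add: is_derivation_1[OF assms])

lemma is_derivation_lincomb:
  assumes "is_derivation D1" "is_derivation D2" "is_derivation D3"
  shows "is_derivation (\<lambda>f. u * D1 f + v * D2 f + w * D3 f)"
  using assms by (simp add: is_derivation_def algebra_simps)

lemmas is_derivation_partials = is_derivation_pderiv is_derivation_map_poly[OF is_derivation_pderiv]
  is_derivation_map_poly[OF is_derivation_map_poly[OF is_derivation_pderiv]]

lemma is_derivation_chazyV_field: "is_derivation chazyV_field"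
  unfolding chazyV_field_def[abs_def] partial_x_def partial_y_def partial_z_def
  by (intro is_derivation_lincomb is_derivation_fract_deriv is_derivation_partials)

text \<open>Together with the derivation rules, these values determine the field on every rational
  expression in the coordinates that occurs below, so no lowest terms have to be computed.\<close>

lemma chazyV_field_vars:
  "chazyV_field RX = RY" "chazyV_field RY = RZ" "chazyV_field RZ = chazyV_rhs RX RY RZ"
  unfolding chazyV_field_def partial_x_def partial_y_def partial_z_def
  by (simp_all add: RX_def RY_def RZ_def fract_deriv_to_fract is_derivation_partials
      map_poly_pCons pderiv_pCons map_poly_1 pderiv_1 is_derivation_1
      flip: one_pCons)

section \<open>Composition with a rational map\<close>

definition is_ring_hom :: "('a::comm_ring_1 \<Rightarrow> 'b::comm_ring_1) \<Rightarrow> bool" where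
  "is_ring_hom h \<longleftrightarrow>
     h 1 = 1 \<and> (\<forall>p q. h (p + q) = h p + h q) \<and> (\<forall>p q. h (p * q) = h p * h q)"

lemma is_ring_hom_1: "is_ring_hom h \<Longrightarrow> h 1 = 1"
  and is_ring_hom_add: "is_ring_hom h \<Longrightarrow> h (p + q) = h p + h q"
  and is_ring_hom_mult: "is_ring_hom h \<Longrightarrow> h (p * q) = h p * h q"
  by (simp_all add: is_ring_hom_def)

lemma is_ring_hom_0: "is_ring_hom h \<Longrightarrow> h 0 = 0"
  using is_ring_hom_add[of h 0 0] by simp

lemma is_ring_hom_uminus: "is_ring_hom h \<Longrightarrow> h (- p) = - h p"
  using is_ring_hom_add[of h p "- p"] is_ring_hom_0[of h] by (simp add: eq_neg_iff_add_eq_0 add.commute)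

text \<open>One layer of evaluation; three applications, starting from the embedding of constants,
  give substitution into \<open>poly3\<close>.\<close>

lemma is_ring_hom_poly_map_poly:
  assumes h: "is_ring_hom h"
  shows "is_ring_hom (\<lambda>p. poly (map_poly h p) u)"
  unfolding is_ring_hom_def
proof (intro conjI allI)
  note c = coeff_map_poly[of h, OF is_ring_hom_0[OF h]]
  have "h (sum f A) = (\<Sum>i\<in>A. h (f i))" if "finite A" for f and A :: "nat set"
    using that by induction (simp_all add: is_ring_hom_0[OF h] is_ring_hom_add[OF h])
  then have "map_poly h (p * q) = map_poly h p * map_poly h q" for p q
    by (intro poly_eqI) (simp add: c coeff_mult is_ring_hom_mult[OF h])
  then show "poly (map_poly h (p * q)) u = poly (map_poly h p) u * poly (map_poly h q) u" for p q
    by simp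
  have "map_poly h (p + q) = map_poly h p + map_poly h q" for p q
    by (rule poly_eqI) (simp add: c is_ring_hom_add[OF h])
  then show "poly (map_poly h (p + q)) u = poly (map_poly h p) u + poly (map_poly h q) u" for p q
    by simp
  show "poly (map_poly h 1) u = 1"
    by (simp add: map_poly_1 is_ring_hom_1[OF h])
qed

lemma is_ring_hom_ratfun3_const: "is_ring_hom ratfun3_const"
  unfolding is_ring_hom_def ratfun3_const_def
  by (simp flip: to_fract_add to_fract_mult one_pCons)

lemma is_ring_hom_poly3_subst: "is_ring_hom (\<lambda>p. poly3_subst p G)"
proof (cases G)
  case (fields u v w)
  show ?thesis
    unfolding fields poly3_subst_def prod.case
    by (intro is_ring_hom_poly_map_poly is_ring_hom_ratfun3_const)
qed

section \<open>Composition of rational functions, with definedness\<close>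

text \<open>Definedness and value are bundled so that both propagate together through the arithmetic
  operations.\<close>

definition ratfun3_subst_eq :: "ratfun3 \<Rightarrow> ratmap3 \<Rightarrow> ratfun3 \<Rightarrow> bool" where
  "ratfun3_subst_eq f G g \<longleftrightarrow> ratfun3_substitutable f G \<and> ratfun3_subst f G = g"

text \<open>Any representation a/b whose denominator survives along \<open>G\<close> suffices. By
  coprimality the reduced denominator divides \<open>b\<close>, so it survives too, and substituting
  into the cross-multiplied identity gives equal values.\<close>

lemma ratfun3_subst_eqI:
  assumes b: "poly3_subst b G \<noteq> 0" and f: "f = to_fract a / to_fract b"
    and g: "g = poly3_subst a G / poly3_subst b G"
  shows "ratfun3_subst_eq f G g"
proof -
  note hom = is_ring_hom_poly3_subst[of G]
  have b0: "b \<noteq> 0"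
    using b is_ring_hom_0[OF hom] by auto
  define p q where "p = fst (quot_of_fract f)" and "q = snd (quot_of_fract f)"
  have e: "p * b = a * q"
    using fract_rep_cross_mult[OF b0 f] by (simp add: p_def q_def)
  have "coprime p q"
    unfolding p_def q_def by (rule coprime_quot_of_fract)
  moreover have "q dvd p * b"
    using e by simp
  ultimately have "q dvd b"
    by (simp add: coprime_commute coprime_dvd_mult_right_iff)
  then obtain c where "b = q * c" ..
  then have q: "poly3_subst q G \<noteq> 0"
    using b by (auto simp: is_ring_hom_mult[OF hom])
  have "poly3_subst p G * poly3_subst b G = poly3_subst a G * poly3_subst q G"
    using arg_cong[OF e, of "\<lambda>p. poly3_subst p G"] by (simp add: is_ring_hom_mult[OF hom])
  then show ?thesis
    unfolding ratfun3_subst_eq_def ratfun3_substitutable_def ratfun3_subst_def g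
      p_def[symmetric] q_def[symmetric]
    using b q by (simp add: frac_eq_eq)
qed

lemma ratfun3_subst_eqE:
  assumes "ratfun3_subst_eq f G g"
  obtains a b where "poly3_subst b G \<noteq> 0" "f = to_fract a / to_fract b"
    "g = poly3_subst a G / poly3_subst b G" "b \<noteq> 0"
proof (rule that)
  show "f = to_fract (fst (quot_of_fract f)) / to_fract (snd (quot_of_fract f))"
    by (simp flip: Fract_conv_to_fract)
qed (use assms in \<open>auto simp: ratfun3_subst_eq_def ratfun3_substitutable_def ratfun3_subst_def\<close>)

lemma ratfun3_subst_eq_add:
  assumes "ratfun3_subst_eq f1 G g1" "ratfun3_subst_eq f2 G g2"
  shows "ratfun3_subst_eq (f1 + f2) G (g1 + g2)"
proof -
  note hom = is_ring_hom_mult[OF is_ring_hom_poly3_subst] is_ring_hom_add[OF is_ring_hom_poly3_subst]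
  obtain a b where 1: "poly3_subst b G \<noteq> 0" "f1 = to_fract a / to_fract b"
    "g1 = poly3_subst a G / poly3_subst b G" "b \<noteq> 0"
    by (rule ratfun3_subst_eqE[OF assms(1)])
  obtain c d where 2: "poly3_subst d G \<noteq> 0" "f2 = to_fract c / to_fract d"
    "g2 = poly3_subst c G / poly3_subst d G" "d \<noteq> 0"
    by (rule ratfun3_subst_eqE[OF assms(2)])
  show ?thesis
    by (rule ratfun3_subst_eqI[of "b * d" _ _ "a * d + c * b"])
      (use 1 2 in \<open>simp_all add: hom add_frac_eq\<close>)
qed

lemma ratfun3_subst_eq_mult:
  assumes "ratfun3_subst_eq f1 G g1" "ratfun3_subst_eq f2 G g2"
  shows "ratfun3_subst_eq (f1 * f2) G (g1 * g2)"
proof -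
  note hom = is_ring_hom_mult[OF is_ring_hom_poly3_subst]
  obtain a b where 1: "poly3_subst b G \<noteq> 0" "f1 = to_fract a / to_fract b"
    "g1 = poly3_subst a G / poly3_subst b G" "b \<noteq> 0"
    by (rule ratfun3_subst_eqE[OF assms(1)])
  obtain c d where 2: "poly3_subst d G \<noteq> 0" "f2 = to_fract c / to_fract d"
    "g2 = poly3_subst c G / poly3_subst d G" "d \<noteq> 0"
    by (rule ratfun3_subst_eqE[OF assms(2)])
  show ?thesis
    by (rule ratfun3_subst_eqI[of "b * d" _ _ "a * c"]) (use 1 2 in \<open>simp_all add: hom\<close>)
qed

lemma ratfun3_subst_eq_uminus:
  assumes "ratfun3_subst_eq f G g"
  shows "ratfun3_subst_eq (- f) G (- g)"
proof -
  obtain a b where "poly3_subst b G \<noteq> 0" "f = to_fract a / to_fract b"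
    "g = poly3_subst a G / poly3_subst b G" "b \<noteq> 0"
    by (rule ratfun3_subst_eqE[OF assms])
  then show ?thesis
    by (intro ratfun3_subst_eqI[of b _ _ "- a"])
      (simp_all add: is_ring_hom_uminus[OF is_ring_hom_poly3_subst])
qed

text \<open>A nonzero value \<open>g\<close> means that the numerator does not vanish along
  \<open>G\<close>, so it can serve as the new denominator.\<close>

lemma ratfun3_subst_eq_inverse:
  assumes "ratfun3_subst_eq f G g" "g \<noteq> 0"
  shows "ratfun3_subst_eq (inverse f) G (inverse g)"
proof -
  obtain a b where "poly3_subst b G \<noteq> 0" "f = to_fract a / to_fract b"
    "g = poly3_subst a G / poly3_subst b G" "b \<noteq> 0"
    by (rule ratfun3_subst_eqE[OF assms(1)])
  then show ?thesis
    using assms(2) by (intro ratfun3_subst_eqI[of a _ _ b]) simp_all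
qed

lemma ratfun3_subst_eq_diff:
  "ratfun3_subst_eq f1 G g1 \<Longrightarrow> ratfun3_subst_eq f2 G g2 \<Longrightarrow> ratfun3_subst_eq (f1 - f2) G (g1 - g2)"
  using ratfun3_subst_eq_add[OF _ ratfun3_subst_eq_uminus] by fastforce

lemma ratfun3_subst_eq_divide:
  "ratfun3_subst_eq f1 G g1 \<Longrightarrow> ratfun3_subst_eq f2 G g2 \<Longrightarrow> g2 \<noteq> 0 \<Longrightarrow>
    ratfun3_subst_eq (f1 / f2) G (g1 / g2)"
  unfolding divide_inverse by (intro ratfun3_subst_eq_mult ratfun3_subst_eq_inverse)

lemma ratfun3_subst_eq_power2:
  "ratfun3_subst_eq f G g \<Longrightarrow> ratfun3_subst_eq (f ^ 2) G (g ^ 2)"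
  unfolding power2_eq_square by (rule ratfun3_subst_eq_mult)

lemma ratfun3_subst_eq_vars:
  "ratfun3_subst_eq RX (u, v, w) u"
  "ratfun3_subst_eq RY (u, v, w) v"
  "ratfun3_subst_eq RZ (u, v, w) w"
  unfolding RX_def RY_def RZ_def
  by (rule ratfun3_subst_eqI[of 1 _ _ "[:[:[:0, 1:]:]:]"]
           ratfun3_subst_eqI[of 1 _ _ "[:[:0, 1:]:]"]
           ratfun3_subst_eqI[of 1 _ _ "[:0, 1:]"];
      simp add: is_ring_hom_1[OF is_ring_hom_poly3_subst];
      simp add: poly3_subst_def map_poly_pCons is_ring_hom_0[OF is_ring_hom_ratfun3_const]
        is_ring_hom_1[OF is_ring_hom_ratfun3_const] map_poly_1)+

section \<open>The involution\<close>

lemma RX_RY_RZ_nonzero: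
  "RX ^ 2 - RY \<noteq> 0"
  "(RX ^ 2 + RY) * (RX ^ 2 - RY) - (RX + RX) * (RX * RY + RX * RY - RZ) \<noteq> 0"
proof -
  define X Y Z :: poly3 where "X = [:[:[:0, 1:]:]:]" and "Y = [:[:0, 1:]:]" and "Z = [:0, 1:]"
  have "RX ^ 2 - RY = to_fract (X ^ 2 - Y)"
    by (simp add: RX_def RY_def X_def Y_def power2_eq_square flip: to_fract_mult to_fract_diff)
  moreover have "X ^ 2 - Y \<noteq> 0"
    by (simp add: X_def Y_def power2_eq_square)
  ultimately show "RX ^ 2 - RY \<noteq> 0"
    by simp
  have "(RX ^ 2 + RY) * (RX ^ 2 - RY) - (RX + RX) * (RX * RY + RX * RY - RZ) =
    to_fract ((X ^ 2 + Y) * (X ^ 2 - Y) - (X + X) * (X * Y + X * Y - Z))"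
    by (simp add: RX_def RY_def RZ_def X_def Y_def Z_def power2_eq_square
        flip: to_fract_mult to_fract_diff to_fract_add)
  \<comment> \<open>The first integral P is linear in the outermost variable z, with leading
    coefficient 2x.\<close>
  moreover have "coeff ((X ^ 2 + Y) * (X ^ 2 - Y) - (X + X) * (X * Y + X * Y - Z)) 1 \<noteq> 0"
    by (simp add: X_def Y_def Z_def power2_eq_square)
  then have "(X ^ 2 + Y) * (X ^ 2 - Y) - (X + X) * (X * Y + X * Y - Z) \<noteq> 0"
    by (metis coeff_0)
  ultimately show "(RX ^ 2 + RY) * (RX ^ 2 - RY) - (RX + RX) * (RX * RY + RX * RY - RZ) \<noteq> 0"
    by (simp only: to_fract_eq_0_iff not_False_eq_True)
qed

lemma chazyV_ratmap_involutive: "ratmap3_involutive (chazyV_ratmap (chazyV_sub RX RY RZ))"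
proof -
  note W = is_derivation_chazyV_field
  define q where "q = (RX * RY + RX * RY - RZ) / (RX ^ 2 - RY)"
  define X Y Z where "X = RX - q" and "Y = q ^ 2 - RY"
    and "Z = (q * (RY + RY - q ^ 2) + q * (RY + RY - q ^ 2)) - RZ"
  note D = RX_RY_RZ_nonzero(1)
  have WD: "chazyV_field (RX ^ 2 - RY) = RX * RY + RX * RY - RZ"
    by (simp only: is_derivation_diff[OF W] is_derivation_power2[OF W] chazyV_field_vars mult_2)
  have WN: "chazyV_field (RX * RY + RX * RY - RZ) =
      RY * RY + RX * RZ + (RY * RY + RX * RZ) - chazyV_rhs RX RY RZ"
    by (simp only: is_derivation_diff[OF W] is_derivation_add[OF W] is_derivation_mult[OF W]
        chazyV_field_vars)
  have Wq: "chazyV_field q = RY + RY - q ^ 2"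
    unfolding log_deriv_flow_eq[OF D q_def, symmetric] unfolding q_def
      is_derivation_divide[OF W D] WD WN by (rule refl)
  have sub: "chazyV_sub RX RY RZ = X"
    using chazyV_sub_eq[OF D] by (simp add: X_def q_def)
  have WX: "chazyV_field X = Y"
    unfolding X_def Y_def is_derivation_diff[OF W] chazyV_field_vars Wq by simp
  have WY: "chazyV_field Y = Z"
    unfolding Y_def Z_def is_derivation_diff[OF W] is_derivation_power2[OF W] chazyV_field_vars Wq
    by (simp only: mult_2)
  \<comment> \<open>This denominator is P/D, and both P and D are nonzero; hence the map can be
    composed with itself.\<close>
  have E: "X ^ 2 - Y \<noteq> 0"
    using RX_RY_RZ_nonzero D
    unfolding X_def Y_def chazyV_transformed_denominator[OF D q_def] by simp
  have Q: "(X * Y + X * Y - Z) / (X ^ 2 - Y) = - q"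
    using chazyV_transformed_log_deriv[OF D q_def E[unfolded X_def Y_def]]
    by (simp only: X_def Y_def Z_def mult_2)
  note subst = ratfun3_subst_eq_vars[of X Y Z] ratfun3_subst_eq_add ratfun3_subst_eq_diff
    ratfun3_subst_eq_mult ratfun3_subst_eq_power2
  \<comment> \<open>By \<open>Q\<close>, the target \<open>- q\<close> is the defining quotient of
    \<open>q\<close> with the coordinates replaced by \<open>X\<close>, \<open>Y\<close>,
    \<open>Z\<close>, so the composition rules match it term by term.\<close>
  have sq: "ratfun3_subst_eq q (X, Y, Z) (- q)"
    unfolding Q[symmetric] by (subst q_def) (intro subst ratfun3_subst_eq_divide E)
  have "ratfun3_subst_eq X (X, Y, Z) (X - (- q))"
    by (subst X_def, intro subst sq)
  then have sX: "ratfun3_subst_eq X (X, Y, Z) RX"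
    by (simp add: X_def)
  have "ratfun3_subst_eq Y (X, Y, Z) ((- q) ^ 2 - Y)"
    by (subst Y_def, intro subst sq)
  then have sY: "ratfun3_subst_eq Y (X, Y, Z) RY"
    by (simp add: Y_def)
  have "ratfun3_subst_eq Z (X, Y, Z)
    ((- q * (Y + Y - (- q) ^ 2) + - q * (Y + Y - (- q) ^ 2)) - Z)"
    by (subst Z_def, intro subst sq)
  \<comment> \<open>Since Y = q^2 - y, the factor 2Y - q^2 equals -(2y - q^2). The two sign changes
    cancel, and subtracting \<open>Z\<close> leaves z.\<close>
  also have "(- q * (Y + Y - (- q) ^ 2) + - q * (Y + Y - (- q) ^ 2)) - Z = RZ"
    unfolding Z_def Y_def by (simp add: algebra_simps)
  finally have sZ: "ratfun3_subst_eq Z (X, Y, Z) RZ" .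
  show ?thesis
    using sX sY sZ
    unfolding chazyV_ratmap_def sub WX WY ratmap3_involutive_def ratmap3_composable_def
      ratmap3_comp_def ratmap3_id_def ratfun3_subst_eq_def by simp
qed

theorem theorem7:
  shows "(\<forall>(U :: complex set) (x :: complex \<Rightarrow> complex).
            open U \<longrightarrow> connected U \<longrightarrow> chazyV_solution_on x U \<longrightarrow>
            \<not> (\<forall>t\<in>U. x analytic_on {t} \<longrightarrow> x t ^ 2 - deriv x t = 0) \<longrightarrow>
            chazyV_solution_on (\<lambda>t. chazyV_sub (x t) (deriv x t) ((deriv ^^ 2) x t)) U)
         \<and> ratmap3_involutive (chazyV_ratmap (chazyV_sub RX RY RZ))"
  using chazyV_sub_solution_on chazyV_ratmap_involutive by blast

end
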